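(* Let $\mathbb{K}$ be a field of characteristic $0$, let $\alpha_\sigma,\beta_\sigma\in\mathbb{K}$ for $\sigma\in\mathbb{S}_3$, and let $\mathrm{Var}$ be the variety of (not necessarily associative) $\mathbb{K}$-algebras with one bilinear operation defined by the single identity $$\sum_{\sigma\in\mathbb{S}_3}\alpha_\sigma\,(x_{\sigma(1)}x_{\sigma(2)})x_{\sigma(3)}+\sum_{\sigma\in\mathbb{S}_3}\beta_\sigma\,x_{\sigma(1)}(x_{\sigma(2)}x_{\sigma(3)})=0 .$$ Let $A=(A,\vdash,\dashv)$ be a $\mathrm{Var}$-dialgebra. Then the algebra $A^{(\star)}=(A,\star)$, where $a\star b=\tfrac12(a\vdash b+a\dashv b)$, belongs to $\mathrm{Var}$ if and only if $A$ satisfies the identity $$\sum_{\sigma\in\mathbb{S}_3}\alpha_\sigma\,(x_{\sigma(1)}\vdash x_{\sigma(2)})\vdash x_{\sigma(3)}+\sum_{\sigma\in\mathbb{S}_3}\beta_\sigma\,x_{\sigma(1)}\dashv(x_{\sigma(2)}\dashv x_{\sigma(3)})=0 .$$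
   Context: A $\mathrm{Var}$-dialgebra (for $\mathrm{Var}$ defined by the single displayed degree-three identity) is a $\mathbb{K}$-vector space with two bilinear operations $\vdash,\dashv$ satisfying the $0$-identities $$a\dashv(b\dashv c)=a\dashv(b\vdash c),\qquad (a\vdash b)\vdash c=(a\dashv b)\vdash c,$$ together with three identities, one for each choice of a central letter $x_m$, $m\in\{1,2,3\}$. The identity for the central letter $x_m$ is obtained from the defining identity of $\mathrm{Var}$ by replacing each monomial as follows (here $\{i,j,k\}=\{1,2,3\}$): - $(x_ix_j)x_k$ is replaced by $(x_i\dashv x_j)\dashv x_k$ if $m=i$, by $(x_i\vdash x_j)\dashv x_k$ if $m=j$, and by $(x_i\vdash x_j)\vdash x_k$ if $m=k$; - $x_i(x_jx_k)$ is replaced by $x_i\dashv(x_j\vdash x_k)$ if $m=i$, by $x_i\vdash(x_j\dashv x_k)$ if $m=j$, and by $x_i\vdash(x_j\vdash x_k)$ if $m=k$. *)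

theory Defs
  imports Complex_Main "HOL-Combinatorics.Permutations"
begin

locale bilinear_operation = vector_space scale
  for scale :: "'k::field \<Rightarrow> 'a::ab_group_add \<Rightarrow> 'a" +
  fixes prd :: "'a \<Rightarrow> 'a \<Rightarrow> 'a"
  assumes linear_right: "\<And>a. Vector_Spaces.linear scale scale (\<lambda>b. prd a b)"
    and linear_left: "\<And>b. Vector_Spaces.linear scale scale (\<lambda>a. prd a b)"

text \<open>
  The left-hand side of a multilinear identity of degree three. The arguments \<open>L\<close> and \<open>R\<close> give
  the values of the two monomials with the letters \<open>x\<^sub>i, x\<^sub>j, x\<^sub>k\<close> in this order, bracketed to
  the left and to the right respectively. They receive the indices of the letters, not their
  values, because the dialgebra monomials below depend on which letter is the central one.
  The symmetric group is the set of permutations of \<open>{1, 2, 3}\<close>, so the values of \<open>\<alpha>\<close> and \<open>\<beta>\<close>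
  at other functions are irrelevant.
\<close>

definition multilinear3 ::
  "('k \<Rightarrow> 'a \<Rightarrow> 'a) \<Rightarrow> ((nat \<Rightarrow> nat) \<Rightarrow> 'k) \<Rightarrow> ((nat \<Rightarrow> nat) \<Rightarrow> 'k) \<Rightarrow>
    (nat \<Rightarrow> nat \<Rightarrow> nat \<Rightarrow> 'a) \<Rightarrow> (nat \<Rightarrow> nat \<Rightarrow> nat \<Rightarrow> 'a) \<Rightarrow> 'a::ab_group_add"
  where
    "multilinear3 scale \<alpha> \<beta> L R =
      (\<Sum>\<sigma> | \<sigma> permutes {1, 2, 3}. scale (\<alpha> \<sigma>) (L (\<sigma> 1) (\<sigma> 2) (\<sigma> 3))) +
      (\<Sum>\<sigma> | \<sigma> permutes {1, 2, 3}. scale (\<beta> \<sigma>) (R (\<sigma> 1) (\<sigma> 2) (\<sigma> 3)))"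

locale var_algebra = bilinear_operation scale prd
  for scale :: "'k::field \<Rightarrow> 'a::ab_group_add \<Rightarrow> 'a"
    and prd :: "'a \<Rightarrow> 'a \<Rightarrow> 'a" (infixl \<open>\<cdot>\<close> 70) +
  fixes \<alpha> \<beta> :: "(nat \<Rightarrow> nat) \<Rightarrow> 'k"
  assumes var_identity:
    "\<And>x :: nat \<Rightarrow> 'a.
      multilinear3 scale \<alpha> \<beta> (\<lambda>i j k. (x i \<cdot> x j) \<cdot> x k) (\<lambda>i j k. x i \<cdot> (x j \<cdot> x k)) = 0"

text \<open>
  The dialgebra monomials replacing \<open>(x\<^sub>i x\<^sub>j) x\<^sub>k\<close> and \<open>x\<^sub>i (x\<^sub>j x\<^sub>k)\<close> when \<open>x\<^sub>m\<close> is the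
  central letter. They are used only for \<open>{i, j, k} = {1, 2, 3}\<close> and \<open>m \<in> {1, 2, 3}\<close>, so that the
  last branch is the case \<open>m = k\<close>.
\<close>

definition central_left ::
  "('a \<Rightarrow> 'a \<Rightarrow> 'a) \<Rightarrow> ('a \<Rightarrow> 'a \<Rightarrow> 'a) \<Rightarrow> nat \<Rightarrow> (nat \<Rightarrow> 'a) \<Rightarrow> nat \<Rightarrow> nat \<Rightarrow> nat \<Rightarrow> 'a"
  where
    "central_left vd dv m x i j k =
      (if m = i then dv (dv (x i) (x j)) (x k)
       else if m = j then dv (vd (x i) (x j)) (x k)
       else vd (vd (x i) (x j)) (x k))"

definition central_right ::
  "('a \<Rightarrow> 'a \<Rightarrow> 'a) \<Rightarrow> ('a \<Rightarrow> 'a \<Rightarrow> 'a) \<Rightarrow> nat \<Rightarrow> (nat \<Rightarrow> 'a) \<Rightarrow> nat \<Rightarrow> nat \<Rightarrow> nat \<Rightarrow> 'a"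
  where
    "central_right vd dv m x i j k =
      (if m = i then dv (x i) (vd (x j) (x k))
       else if m = j then vd (x i) (dv (x j) (x k))
       else vd (x i) (vd (x j) (x k)))"

locale var_dialgebra =
  vd: bilinear_operation scale vd + dv: bilinear_operation scale dv
  for scale :: "'k::field \<Rightarrow> 'a::ab_group_add \<Rightarrow> 'a"
    and vd :: "'a \<Rightarrow> 'a \<Rightarrow> 'a" (infixl \<open>\<turnstile>\<close> 70)
    and dv :: "'a \<Rightarrow> 'a \<Rightarrow> 'a" (infixl \<open>\<stileturn>\<close> 70) +
  fixes \<alpha> \<beta> :: "(nat \<Rightarrow> nat) \<Rightarrow> 'k"
  assumes zero_identity_right: "\<And>a b c. a \<stileturn> (b \<stileturn> c) = a \<stileturn> (b \<turnstile> c)"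
    and zero_identity_left: "\<And>a b c. (a \<turnstile> b) \<turnstile> c = (a \<stileturn> b) \<turnstile> c"
    and central_identity:
      "\<And>m (x :: nat \<Rightarrow> 'a). m \<in> {1, 2, 3} \<Longrightarrow>
        multilinear3 scale \<alpha> \<beta>
          (central_left (\<turnstile>) (\<stileturn>) m x) (central_right (\<turnstile>) (\<stileturn>) m x) = 0"

end

theory Submission
  imports Defs
begin

text \<open>
  By the \<open>0\<close>-identities, four times \<open>(a \<star> b) \<star> c\<close> is the sum of the three dialgebra monomials
  replacing \<open>(ab)c\<close>, one for each central letter, plus a second copy of \<open>(a \<turnstile> b) \<turnstile> c\<close>; likewise four
  times \<open>a \<star> (b \<star> c)\<close> is the sum of the three monomials replacing \<open>a(bc)\<close>, plus \<open>a \<stileturn> (b \<stileturn> c)\<close>.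
  Hence four times the identity of \<open>Var\<close> for \<open>\<star>\<close> is the sum of the three dialgebra identities, which
  vanishes, plus the extra identity.
\<close>

lemma permutes_123_image:
  fixes \<sigma> :: "nat \<Rightarrow> nat"
  assumes "\<sigma> permutes {1, 2, 3}"
  shows "{\<sigma> 1, \<sigma> 2, \<sigma> 3} = {1, 2, 3}"
  using permutes_image[OF assms] by simp

text \<open>Permutations of \<open>{1, 2, 3}\<close> produce only index triples exhausting this set,
  so monomials may be compared on such triples alone. This matters for \<open>central_left\<close>
  and \<open>central_right\<close>, whose last branch means \<open>m = k\<close> only there.\<close>

lemma multilinear3_cong:
  assumes "\<And>i j k. {i, j, k} = {1, 2, 3} \<Longrightarrow> L i j k = L' i j k"
    and "\<And>i j k. {i, j, k} = {1, 2, 3} \<Longrightarrow> R i j k = R' i j k"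
  shows "multilinear3 scale \<alpha> \<beta> L R = multilinear3 scale \<alpha> \<beta> L' R'"
  unfolding multilinear3_def
  by (intro arg_cong2[where f = "(+)"] sum.cong refl arg_cong[where f = "scale _"] assms
      permutes_123_image) auto

context vector_space
begin

lemma multilinear3_add:
  "multilinear3 scale \<alpha> \<beta> (\<lambda>i j k. L i j k + L' i j k) (\<lambda>i j k. R i j k + R' i j k) =
    multilinear3 scale \<alpha> \<beta> L R + multilinear3 scale \<alpha> \<beta> L' R'"
  by (simp add: multilinear3_def scale_right_distrib sum.distrib algebra_simps)

lemma multilinear3_scale:
  "multilinear3 scale \<alpha> \<beta> (\<lambda>i j k. scale c (L i j k)) (\<lambda>i j k. scale c (R i j k)) =
    scale c (multilinear3 scale \<alpha> \<beta> L R)"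
  by (simp add: multilinear3_def scale_right_distrib scale_sum_right mult.commute)

end

context bilinear_operation
begin

lemma prd_add_left: "prd (a + b) c = prd a c + prd b c"
  using linear_left[of c] by (rule module_hom.add[OF linear_iff_module_hom[THEN iffD1]])

lemma prd_add_right: "prd a (b + c) = prd a b + prd a c"
  using linear_right[of a] by (rule module_hom.add[OF linear_iff_module_hom[THEN iffD1]])

lemma prd_scale_left: "prd (scale r a) b = scale r (prd a b)"
  using linear_left[of b] by (rule module_hom.scale[OF linear_iff_module_hom[THEN iffD1]])

lemma prd_scale_right: "prd a (scale r b) = scale r (prd a b)"
  using linear_right[of a] by (rule module_hom.scale[OF linear_iff_module_hom[THEN iffD1]])

end

text \<open>With \<open>c = 1 / 2\<close> this provides the bilinearity that membership in the
  variety demands of the averaged product.\<close>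

lemma bilinear_operation_scale_add:
  assumes "bilinear_operation scale f" and "bilinear_operation scale g"
  shows "bilinear_operation scale (\<lambda>a b. scale c (f a b + g a b))"
proof -
  interpret f: bilinear_operation scale f by fact
  interpret g: bilinear_operation scale g by fact
  show ?thesis
    by unfold_locales
      (simp_all add: f.prd_add_left f.prd_add_right f.prd_scale_left f.prd_scale_right
        g.prd_add_left g.prd_add_right g.prd_scale_left g.prd_scale_right
        f.scale_right_distrib mult.commute add_ac)
qed

lemma eq_123_cases:
  fixes i j k :: nat
  assumes "{i, j, k} = {1, 2, 3}"
  shows "(i, j, k) \<in> {(1, 2, 3), (1, 3, 2), (2, 1, 3), (2, 3, 1), (3, 1, 2), (3, 2, 1)}"
proof -
  have "i \<in> {1, 2, 3}" "j \<in> {1, 2, 3}" "k \<in> {1, 2, 3}"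
    unfolding assms[symmetric] by simp_all
  moreover have "card {i, j, k} = 3"
    unfolding assms by simp
  then have "i \<noteq> j" "i \<noteq> k" "j \<noteq> k"
    by (auto simp: card_insert_if split: if_splits)
  ultimately show ?thesis
    by (elim insertE emptyE) simp_all
qed

text \<open>As \<open>m\<close> runs through 1, 2, 3 it meets each of \<open>i\<close>,
  \<open>j\<close>, \<open>k\<close> exactly once, so every branch of \<open>central_left\<close>
  contributes one summand, whatever the order of the letters.\<close>

lemma sum_central_left:
  fixes vd dv :: "'a \<Rightarrow> 'a \<Rightarrow> 'a::ab_group_add"
  assumes "{i, j, k} = {1, 2, 3}"
  shows "central_left vd dv 1 x i j k + central_left vd dv 2 x i j k + central_left vd dv 3 x i j k =
    dv (dv (x i) (x j)) (x k) + dv (vd (x i) (x j)) (x k) + vd (vd (x i) (x j)) (x k)"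
  using eq_123_cases[OF assms] by (auto simp: central_left_def add_ac)

lemma sum_central_right:
  fixes vd dv :: "'a \<Rightarrow> 'a \<Rightarrow> 'a::ab_group_add"
  assumes "{i, j, k} = {1, 2, 3}"
  shows "central_right vd dv 1 x i j k + central_right vd dv 2 x i j k + central_right vd dv 3 x i j k =
    dv (x i) (vd (x j) (x k)) + vd (x i) (dv (x j) (x k)) + vd (x i) (vd (x j) (x k))"
  using eq_123_cases[OF assms] by (auto simp: central_right_def add_ac)

theorem theorem3p1:
  fixes scale :: "'k::field_char_0 \<Rightarrow> 'a::ab_group_add \<Rightarrow> 'a"
    and vd :: "'a \<Rightarrow> 'a \<Rightarrow> 'a" (infixl \<open>\<turnstile>\<close> 70)
    and dv :: "'a \<Rightarrow> 'a \<Rightarrow> 'a" (infixl \<open>\<stileturn>\<close> 70)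
    and \<alpha> \<beta> :: "(nat \<Rightarrow> nat) \<Rightarrow> 'k"
  assumes "var_dialgebra scale (\<turnstile>) (\<stileturn>) \<alpha> \<beta>"
  shows "var_algebra scale (\<lambda>a b. scale (1 / 2) (a \<turnstile> b + a \<stileturn> b)) \<alpha> \<beta> \<longleftrightarrow>
    (\<forall>x :: nat \<Rightarrow> 'a.
      multilinear3 scale \<alpha> \<beta>
        (\<lambda>i j k. (x i \<turnstile> x j) \<turnstile> x k) (\<lambda>i j k. x i \<stileturn> (x j \<stileturn> x k)) = 0)"
proof -
  interpret var_dialgebra scale vd dv \<alpha> \<beta> by fact
  define star where "star = (\<lambda>a b. scale (1 / 2) (a \<turnstile> b + a \<stileturn> b))"
  let ?I = "\<lambda>x. multilinear3 scale \<alpha> \<beta>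
    (\<lambda>i j k. star (star (x i) (x j)) (x k)) (\<lambda>i j k. star (x i) (star (x j) (x k)))"
  let ?E = "\<lambda>x. multilinear3 scale \<alpha> \<beta>
    (\<lambda>i j k. (x i \<turnstile> x j) \<turnstile> x k) (\<lambda>i j k. x i \<stileturn> (x j \<stileturn> x k))"
  let ?C = "\<lambda>m x. multilinear3 scale \<alpha> \<beta>
    (central_left (\<turnstile>) (\<stileturn>) m x) (central_right (\<turnstile>) (\<stileturn>) m x)"
  \<comment> \<open>The factor 4 clears the two halves. Of the four products in the expansion,
    \<open>(a \<stileturn> b) \<turnstile> c\<close> is not a central monomial; the left 0-identity
    turns it into the second \<open>(a \<turnstile> b) \<turnstile> c\<close>.\<close>
  have left: "scale 4 (star (star a b) c) =
      (a \<stileturn> b) \<stileturn> c + (a \<turnstile> b) \<stileturn> c + (a \<turnstile> b) \<turnstile> c + (a \<turnstile> b) \<turnstile> c" for a b c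
    by (simp add: star_def vd.prd_add_left vd.prd_scale_left dv.prd_add_left dv.prd_scale_left
        vd.scale_right_distrib zero_identity_left add_ac)
  have right: "scale 4 (star a (star b c)) =
      a \<stileturn> (b \<turnstile> c) + a \<turnstile> (b \<stileturn> c) + a \<turnstile> (b \<turnstile> c) + a \<stileturn> (b \<stileturn> c)" for a b c
    by (simp add: star_def vd.prd_add_right vd.prd_scale_right dv.prd_add_right dv.prd_scale_right
        vd.scale_right_distrib zero_identity_right add_ac)
  have "scale 4 (?I x) = ?E x" for x
  proof -
    have "scale 4 (?I x) = multilinear3 scale \<alpha> \<beta>
        (\<lambda>i j k. central_left (\<turnstile>) (\<stileturn>) 1 x i j k + central_left (\<turnstile>) (\<stileturn>) 2 x i j k +
          central_left (\<turnstile>) (\<stileturn>) 3 x i j k + (x i \<turnstile> x j) \<turnstile> x k)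
        (\<lambda>i j k. central_right (\<turnstile>) (\<stileturn>) 1 x i j k + central_right (\<turnstile>) (\<stileturn>) 2 x i j k +
          central_right (\<turnstile>) (\<stileturn>) 3 x i j k + x i \<stileturn> (x j \<stileturn> x k))"
      \<comment> \<open>The scalar 4 is moved inside onto each monomial, where \<open>left\<close>
        and \<open>right\<close> apply; the sums over central letters are then recognised triple by
        triple.\<close>
      unfolding vd.multilinear3_scale[symmetric]
      by (intro multilinear3_cong) (simp_all only: left right sum_central_left sum_central_right)
    also have "\<dots> = ?C 1 x + ?C 2 x + ?C 3 x + ?E x"
      by (simp only: vd.multilinear3_add)
    also have "\<dots> = ?E x"
      by (simp add: central_identity)
    finally show ?thesis .
  qed
  \<comment> \<open>In characteristic 0 the scalar 4 is nonzero and can be cancelled, which gives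
    both directions at once.\<close>
  then have "?I x = 0 \<longleftrightarrow> ?E x = 0" for x
    by (metis vd.scale_eq_0_iff zero_neq_numeral)
  moreover have "var_algebra scale star \<alpha> \<beta> \<longleftrightarrow> (\<forall>x. ?I x = 0)"
    using bilinear_operation_scale_add[OF vd.bilinear_operation_axioms dv.bilinear_operation_axioms]
    by (auto simp: var_algebra_def var_algebra_axioms_def star_def)
  ultimately show ?thesis
    by (simp add: star_def)
qed

end
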